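(* The identity-truthfulness gap is strictly greater than $\frac12$. That is, there exists an identity-truthful algorithm $\mathrm{ALG}$ such that $$\Gamma(\mathrm{ALG})=\inf_{F}\min_{\pi}\frac{\mathbb{E}_{\vec v\sim F}[\mathrm{ALG}(F;\pi,\vec v)]}{\mathbb{E}_{\vec v\sim F}[\mathrm{OPT}(F,\pi;\vec v)]}>\frac12 ,$$ where the infimum is over all numbers of boxes $n\ge 1$ and all product distributions $F=F_1\times\cdots\times F_n$ of nonnegative rewards (with $0<\mathbb{E}[\max_i v_i]<\infty$), and the minimum is over all arrival orders $\pi$.
   Context: Setting. There are $n$ boxes; box $k$ contains a nonnegative random reward with known distribution $F_k$, independently across boxes; $F=F_1\times\cdots\times F_n$. An arrival order is a permutation $\pi$ of $\{1,\dots,n\}$: the box arriving at step $i$ is box $\pi^{-1}(i)$ (its index is called its identity), and its reward $v_i\sim F_{\pi^{-1}(i)}$ is revealed at step $i$. The decision-maker must immediately and irrevocably decide whether to accept $v_i$ (and stop) or reject it and continue; at most one reward is accepted, and the obtained reward is $0$ if none is accepted. $\mathrm{OPT}(F,\pi;\vec v)$ is the reward obtained by the optimal online (order-aware) algorithm, i.e. the online algorithm maximizing the expected accepted reward among all online algorithms that know $F$ and $\pi$ from the outset (its decision at step $i$ may depend on $F,\pi,v_1,\dots,v_i$). An identity-truthful algorithm knows $F$ from the outset but not $\pi$; its decision at step $i$ may depend only on $F$, on $v_1,\dots,v_i$, and on the identities $\pi^{-1}(1),\dots,\pi^{-1}(i-1)$ of the previously arrived boxes (and not on $\pi^{-1}(i)$).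 It may use internal randomness, in which case expectations are also over this randomness. $\mathrm{ALG}(F;\pi,\vec v)$ denotes its obtained reward. *)

theory Defs
  imports "HOL-Probability.Probability" "HOL-Combinatorics.Permutations"
begin

text \<open>
  Boxes and steps are numbered from \<open>0\<close>.  An instance is the list \<open>F\<close> of the reward
  distributions, box \<open>k\<close> having law \<open>F ! k\<close>; the number of boxes is \<open>length F\<close>.  An arrival order
  is a permutation \<open>\<pi>\<close> of \<open>{..<length F}\<close>, and the box arriving at step \<open>i\<close> is \<open>inv \<pi> i\<close>.
\<close>

definition valid_instance :: "real measure list \<Rightarrow> bool" where
  "valid_instance F \<longleftrightarrow>
     F \<noteq> [] \<and>
     (\<forall>M \<in> set F. prob_space M \<and> sets M = sets borel \<and> (AE x in M. 0 \<le> x)) \<and>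
     (let E = (\<integral>\<^sup>+ x. ennreal (MAX k\<in>{..<length F}. x k) \<partial>PiM {..<length F} (\<lambda>k. F ! k))
      in 0 < E \<and> E < \<infinity>)"

definition arrival_orders :: "real measure list \<Rightarrow> (nat \<Rightarrow> nat) set" where
  "arrival_orders F = {\<pi>. \<pi> permutes {..<length F}}"

text \<open>The law of the rewards listed by arrival step.\<close>

definition reward_law :: "real measure list \<Rightarrow> (nat \<Rightarrow> nat) \<Rightarrow> (nat \<Rightarrow> real) measure" where
  "reward_law F \<pi> = PiM {..<length F} (\<lambda>i. F ! (inv \<pi> i))"

text \<open>\<open>a i\<close> says whether the reward of step \<open>i\<close> is accepted if that step is reached.\<close>

definition accepted_reward :: "nat \<Rightarrow> (nat \<Rightarrow> bool) \<Rightarrow> (nat \<Rightarrow> real) \<Rightarrow> real" where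
  "accepted_reward n a v = (if \<exists>i<n. a i then v (LEAST i. a i) else 0)"

text \<open>
  For fixed \<open>F\<close> and \<open>\<pi>\<close>, an order-aware online algorithm is a rule deciding about step \<open>i\<close>
  from the rewards of the steps \<open>0, \<dots>, i\<close>.
\<close>

definition order_aware_rules :: "(real list \<Rightarrow> bool) set" where
  "order_aware_rules =
     {d. \<forall>i. (\<lambda>v. d (map v [0..<Suc i])) \<in> PiM {..i} (\<lambda>_. borel) \<rightarrow>\<^sub>M count_space UNIV}"

definition expected_opt :: "real measure list \<Rightarrow> (nat \<Rightarrow> nat) \<Rightarrow> real" where
  "expected_opt F \<pi> =
     (SUP d\<in>order_aware_rules.
        \<integral>v. accepted_reward (length F) (\<lambda>i. d (map v [0..<Suc i])) v \<partial>reward_law F \<pi>)"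

text \<open>
  The internal randomness of an algorithm is a seed drawn from \<open>seed_law F\<close> independently of the
  rewards.  The decision \<open>accept F u vs ids\<close> about step \<open>i\<close> sees the seed \<open>u\<close>, the rewards \<open>vs\<close>
  of the steps \<open>0, \<dots>, i\<close> and the identities \<open>ids\<close> of the boxes of the steps \<open>0, \<dots>, i - 1\<close>, so
  that identity-truthfulness is enforced by the type; the predicate \<open>identity_truthful\<close> only adds
  that the seed law is a probability law and that decisions are measurable.
\<close>

record algorithm =
  seed_law :: "real measure list \<Rightarrow> real measure"
  accept :: "real measure list \<Rightarrow> real \<Rightarrow> real list \<Rightarrow> nat list \<Rightarrow> bool"

definition identity_truthful :: "algorithm \<Rightarrow> bool" where
  "identity_truthful ALG \<longleftrightarrow>
     (\<forall>F. valid_instance F \<longrightarrow>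
        prob_space (seed_law ALG F) \<and>
        (\<forall>ids. (\<lambda>(u, v). accept ALG F u (map v [0..<Suc (length ids)]) ids)
                 \<in> seed_law ALG F \<Otimes>\<^sub>M PiM {..length ids} (\<lambda>_. borel) \<rightarrow>\<^sub>M count_space UNIV))"

definition alg_reward ::
    "algorithm \<Rightarrow> real measure list \<Rightarrow> (nat \<Rightarrow> nat) \<Rightarrow> real \<Rightarrow> (nat \<Rightarrow> real) \<Rightarrow> real" where
  "alg_reward ALG F \<pi> u v =
     accepted_reward (length F)
       (\<lambda>i. accept ALG F u (map v [0..<Suc i]) (map (inv \<pi>) [0..<i])) v"

definition expected_alg :: "algorithm \<Rightarrow> real measure list \<Rightarrow> (nat \<Rightarrow> nat) \<Rightarrow> real" where
  "expected_alg ALG F \<pi> =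
     (\<integral>(u, v). alg_reward ALG F \<pi> u v \<partial>(seed_law ALG F \<Otimes>\<^sub>M reward_law F \<pi>))"

definition Gamma_gap :: "algorithm \<Rightarrow> real" where
  "Gamma_gap ALG =
     (INF F\<in>{F. valid_instance F}. MIN \<pi>\<in>arrival_orders F.
        expected_alg ALG F \<pi> / expected_opt F \<pi>)"

end

(*
  Let tau solve sum_k E(X_k - tau)^+ = tau.  Every online rule earns at most 2 tau, and the single
  threshold tau earns at least tau in every order, so only the orders in which some rule earns
  almost 2 tau matter.  There a near-optimal rule R must almost never end with less than tau and
  must almost never have stopped while some excess E(X_k - tau)^+ is still to come.  Hence, with
  K = 1.1 tau, L = 0.99 tau and w_k = E(X_k - K)^+: the w_k sum to about 0.9 tau, and as long as a
  total w of 0.05 tau is still to come, some remaining reward exceeds L with probability close to 1.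
  This lets an identity-truthful algorithm beat tau in such orders: it uses the threshold K to
  collect some excess for free and falls back on L once the past boxes carry enough w, or once
  some remaining box of large w would still be reached with fair probability under L.  The second
  criterion is what makes the fallback happen before it is too late: if a single box carries nearly
  all of w, the threshold is lowered before that box arrives unless the boxes other than it still
  supply a reward above L with fair probability.  Playing this switching rule with tiny probability
  and the single threshold tau otherwise gains in both kinds of order.
*)
theory Submission imports Defs begin

section \<open>Expected excess over a threshold, first acceptance, survival products\<close>

definition excess :: "real measure \<Rightarrow> real \<Rightarrow> real" where
  "excess D t = (\<integral>x. max 0 (x - t) \<partial>D)"

text \<open>Whether step \<open>i\<close> is reached depends on earlier decisions only, so each
  summand is a reached indicator times a term of step \<open>i\<close>, ready for linearity and
  independence.\<close>

lemma accepted_reward_eq_sum: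
  "accepted_reward n a v = (\<Sum>i<n. (if \<forall>j<i. \<not> a j then 1 else 0) * (if a i then v i else 0))"
proof (cases "\<exists>i<n. a i")
  case True
  define m where "m = (LEAST i. a i)"
  have m: "a m" "m < n" "\<And>j. j < m \<Longrightarrow> \<not> a j"
    using True LeastI_ex[of a] Least_le[of a] not_less_Least[of _ a] unfolding m_def
    by (blast, meson le_less_trans, blast)
  have "(\<Sum>i<n. (if \<forall>j<i. \<not> a j then 1 else 0) * (if a i then v i else 0))
      = (\<Sum>i<n. if i = m then v i else 0)"
    by (intro sum.cong refl) (use m in \<open>auto, metis linorder_neqE_nat\<close>)
  then show ?thesis
    using True m by (auto simp: accepted_reward_def simp flip: m_def)
next
  case False
  then show ?thesis by (auto simp: accepted_reward_def intro!: sum.neutral[symmetric])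
qed

lemma integrable_excess:
  assumes "prob_space D" "integrable D (\<lambda>x. x)"
  shows "integrable D (\<lambda>x::real. max 0 (x - t))"
proof -
  interpret prob_space D by fact
  show ?thesis using assms by auto
qed

lemma excess_nonneg: "0 \<le> excess D t"
  unfolding excess_def by (rule Bochner_Integration.integral_nonneg) simp

lemma excess_antimono:
  assumes "prob_space D" "integrable D (\<lambda>x. x)" "s \<le> t"
  shows "excess D t \<le> excess D s"
  unfolding excess_def
  by (intro integral_mono integrable_excess) (use assms in auto)

text \<open>The integrand is pointwise 1-Lipschitz in the threshold. The resulting continuity feeds
  the intermediate value argument in \<open>balance_level\<close>.\<close>

lemma excess_lipschitz:
  assumes "prob_space D" "integrable D (\<lambda>x. x)"
  shows "\<bar>excess D t - excess D s\<bar> \<le> \<bar>t - s\<bar>"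
proof -
  interpret prob_space D by fact
  note int = integrable_excess[OF assms]
  have "\<bar>excess D t - excess D s\<bar> = \<bar>\<integral>x. max 0 (x - t) - max 0 (x - s) \<partial>D\<bar>"
    unfolding excess_def by (subst Bochner_Integration.integral_diff) (auto intro: int)
  also have "\<dots> \<le> (\<integral>x. \<bar>max 0 (x - t) - max 0 (x - s)\<bar> \<partial>D)"
    by (rule integral_abs_bound)
  also have "\<dots> \<le> (\<integral>x. \<bar>t - s\<bar> \<partial>D)"
    by (intro integral_mono) (auto intro!: int)
  finally show ?thesis by (simp add: prob_space)
qed

text \<open>Above \<open>t\<close> a reward is \<open>t\<close> plus its excess. This separates what
  a threshold rule is paid for stopping at all from the excess it collects.\<close>

lemma integral_above_threshold:
  assumes "prob_space D" "sets D = sets borel" "integrable D (\<lambda>x. x)"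
  shows "integrable D (\<lambda>x::real. if t < x then x else 0)"
    and "(\<integral>x. (if t < x then x else 0) \<partial>D) = t * (1 - measure D {..t}) + excess D t"
proof -
  interpret prob_space D by fact
  note [measurable_cong] = assms(2)
  have sp: "space D = UNIV" using sets_eq_imp_space_eq[OF assms(2)] by simp
  have eq: "(\<lambda>x. if t < x then x else 0) = (\<lambda>x. t * indicator {t<..} x + max 0 (x - t))"
    by (auto simp: indicator_def)
  have [simp]: "{t<..} \<in> sets D" "{..t} \<in> sets D" by (simp_all add: assms(2))
  have "integrable D (indicat_real {t<..})"
    by (rule integrable_real_indicator) (simp_all add: emeasure_eq_measure)
  then have i: "integrable D (\<lambda>x. t * indicator {t<..} x)"
    by simp
  show "integrable D (\<lambda>x::real. if t < x then x else 0)"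
    unfolding eq by (intro Bochner_Integration.integrable_add i integrable_excess assms)
  have "{t<..} = space D - {..t}" using sp by auto
  then have m: "measure D {t<..} = 1 - measure D {..t}"
    by (simp add: prob_compl)
  show "(\<integral>x. (if t < x then x else 0) \<partial>D) = t * (1 - measure D {..t}) + excess D t"
    unfolding eq
    by (subst Bochner_Integration.integral_add[OF i integrable_excess[OF assms(1,3)]])
      (simp add: m excess_def sp)
qed

text \<open>With \<open>p k\<close> the probability of rejecting at step \<open>k\<close>, the
  summands are the probabilities of stopping first at step \<open>i\<close>; the sum
  telescopes.\<close>

lemma sum_survival_from:
  fixes p :: "nat \<Rightarrow> real"
  assumes "a \<le> b"
  shows "(\<Sum>i\<in>{a..<b}. (\<Prod>k\<in>{a..<i}. p k) * (1 - p i)) = 1 - (\<Prod>k\<in>{a..<b}. p k)"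
  using assms by (induction b rule: dec_induct) (simp_all add: algebra_simps)

lemma sum_survival:
  fixes p :: "nat \<Rightarrow> real"
  shows "(\<Sum>i<b. (\<Prod>k<i. p k) * (1 - p i)) = 1 - (\<Prod>k<b. p k)"
  using sum_survival_from[of 0 b p] by (simp add: atLeast0LessThan)

lemma prod_antimono_subset:
  fixes c :: "'a \<Rightarrow> real"
  assumes "finite B" "A \<subseteq> B" "\<And>x. x \<in> B \<Longrightarrow> 0 \<le> c x" "\<And>x. x \<in> B \<Longrightarrow> c x \<le> 1"
  shows "prod c B \<le> prod c A"
proof -
  have "prod c B = prod c A * prod c (B - A)"
    using assms by (metis mult.commute prod.subset_diff)
  also have "\<dots> \<le> prod c A"
    using assms by (intro mult_right_le_one_le prod_nonneg prod_le_1) auto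
  finally show ?thesis .
qed

section \<open>Independent rewards in order of arrival\<close>

text \<open>The laws are indexed by arrival step; only the first \<open>n\<close> of them matter.\<close>

locale reward_sequence =
  fixes n :: nat and M :: "nat \<Rightarrow> real measure"
  assumes prob: "prob_space (M i)"
    and sets_M: "sets (M i) = sets borel"
    and integrable_M: "integrable (M i) (\<lambda>x. x)"
begin

abbreviation "P \<equiv> PiM {..<n} M"

sublocale product_prob_space M "{..<n}"
  using prob by (simp add: product_prob_space_def product_prob_space_axioms_def
      product_sigma_finite_def prob_space_imp_sigma_finite)

declare sets_M [measurable_cong]

lemma integrable_coordinate:
  assumes "i < n" "integrable (M i) g"
  shows "integrable P (\<lambda>v. g (v i) :: real)"
proof -
  have "integrable (distr P (M i) (\<lambda>v. v i)) g"
    using PiM_component[of i] assms by simp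
  then show ?thesis by (rule integrable_distr[rotated]) (use assms in \<open>simp add: measurable_component_singleton\<close>)
qed

text \<open>Fubini with coordinate \<open>i\<close> split off: \<open>h\<close> is constant in that
  coordinate, so it comes out of the inner integral.\<close>

lemma integral_coordinate_times:
  assumes i: "i < n" and h[measurable]: "h \<in> borel_measurable P" and h1: "\<And>v. \<bar>h v\<bar> \<le> 1"
    and indep: "\<And>v y. h (v(i := y)) = h v" and g: "integrable (M i) g"
  shows "integrable P (\<lambda>v. h v * g (v i) :: real)"
    and "(\<integral>v. h v * g (v i) \<partial>P) = (\<integral>v. h v \<partial>P) * (\<integral>x. g x \<partial>M i)"
proof -
  note [measurable] = borel_measurable_integrable[OF g]
  have int: "integrable P (\<lambda>v. h v * g (v i) :: real)" if g: "integrable (M i) g" for g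
  proof (rule Bochner_Integration.integrable_bound[OF integrable_coordinate[OF i g]])
    note [measurable] = borel_measurable_integrable[OF g]
    have [measurable]: "(\<lambda>v. v i) \<in> P \<rightarrow>\<^sub>M M i"
      using i by (intro measurable_component_singleton) simp
    show "(\<lambda>v. h v * g (v i)) \<in> borel_measurable P" by measurable
    show "AE v in P. norm (h v * g (v i)) \<le> norm (g (v i))"
      by (auto simp: abs_mult intro!: mult_left_le_one_le h1)
  qed
  show "integrable P (\<lambda>v. h v * g (v i) :: real)" by (rule int[OF g])
  let ?I = "{..<n} - {i}"
  have ins: "insert i ?I = {..<n}" using i by auto
  have fac: "(\<integral>v. h v * g (v i) \<partial>P) = (\<integral>x. h x \<partial>PiM ?I M) * (\<integral>y. g y \<partial>M i)"
    if "integrable (M i) g" for g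
  proof -
    have "(\<integral>v. h v * g (v i) \<partial>P) = (\<integral>x. (\<integral>y. h (x(i := y)) * g y \<partial>M i) \<partial>PiM ?I M)"
      using product_integral_insert[of ?I i "\<lambda>v. h v * g (v i)"] int[OF that]
      by (simp only: ins) (simp del: insert_Diff_single)
    then show ?thesis by (simp add: indep)
  qed
  show "(\<integral>v. h v * g (v i) \<partial>P) = (\<integral>v. h v \<partial>P) * (\<integral>x. g x \<partial>M i)"
    \<comment> \<open>Taking the constant 1 for \<open>g\<close> identifies the integral of
      \<open>h\<close> over the other coordinates with the one over all of them.\<close>
    using fac[OF g] fac[of "\<lambda>_. 1"] M.prob_space by simp
qed

section \<open>Online rules and their rewards\<close>

text \<open>Adaptedness is stated as invariance under changes of later coordinates, the form of
  independence that \<open>integral_coordinate_times\<close> asks for.\<close>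

definition online :: "(nat \<Rightarrow> (nat \<Rightarrow> real) \<Rightarrow> bool) \<Rightarrow> bool" where
  "online a \<longleftrightarrow> (\<forall>i<n. Measurable.pred P (a i)) \<and> (\<forall>i k v y. i < k \<longrightarrow> a i (v(k := y)) = a i v)"

definition reach :: "(nat \<Rightarrow> (nat \<Rightarrow> real) \<Rightarrow> bool) \<Rightarrow> nat \<Rightarrow> real" where
  "reach a i = (\<integral>v. (if \<forall>j<i. \<not> a j v then 1 else 0) \<partial>P)"

definition reward :: "(nat \<Rightarrow> (nat \<Rightarrow> real) \<Rightarrow> bool) \<Rightarrow> (nat \<Rightarrow> real) \<Rightarrow> real" where
  "reward a v = accepted_reward n (\<lambda>i. a i v) v"

text \<open>The event of \<open>low\<close> includes that nothing is accepted when \<open>t \<ge> 0\<close>.\<close>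

definition low :: "(nat \<Rightarrow> (nat \<Rightarrow> real) \<Rightarrow> bool) \<Rightarrow> real \<Rightarrow> real" where
  "low a t = (\<integral>v. (if reward a v \<le> t then 1 else 0) \<partial>P)"

lemma integrable_if_pred:
  assumes [measurable]: "Measurable.pred P Q"
  shows "integrable P (\<lambda>v. if Q v then 1 else 0 :: real)"
  by (rule integrable_const_bound[where B = 1]) auto

lemma measurable_reached:
  assumes "online a" "i \<le> n"
  shows "Measurable.pred P (\<lambda>v. \<forall>j<i. \<not> a j v)"
proof -
  have [measurable]: "Measurable.pred P (a j)" if "j \<in> {..<i}" for j
    using assms that by (auto simp: online_def)
  have "Measurable.pred P (\<lambda>v. \<forall>j\<in>{..<i}. \<not> a j v)" by measurable
  then show ?thesis by (simp add: lessThan_iff Ball_def)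
qed

lemma reached_indep:
  assumes "online a"
  shows "(\<forall>j<i. \<not> a j (v(i := y))) \<longleftrightarrow> (\<forall>j<i. \<not> a j v)"
  using assms by (auto simp: online_def)

text \<open>The decisions before step \<open>i\<close> ignore the reward of step \<open>i\<close>,
  so reaching the step is independent of that reward.\<close>

lemma integral_reached_times:
  assumes a: "online a" and i: "i < n" and g: "integrable (M i) g"
  shows "integrable P (\<lambda>v. (if \<forall>j<i. \<not> a j v then 1 else 0) * g (v i) :: real)"
    and "(\<integral>v. (if \<forall>j<i. \<not> a j v then 1 else 0) * g (v i) \<partial>P) = reach a i * (\<integral>x. g x \<partial>M i)"
proof -
  have m: "(\<lambda>v. if \<forall>j<i. \<not> a j v then 1 else 0 :: real) \<in> borel_measurable P"
    using i by (intro borel_measurable_integrable integrable_if_pred measurable_reached[OF a]) simp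
  note * = integral_coordinate_times[OF i m _ _ g]
  show "integrable P (\<lambda>v. (if \<forall>j<i. \<not> a j v then 1 else 0) * g (v i) :: real)"
    by (rule *) (simp_all add: reached_indep[OF a])
  show "(\<integral>v. (if \<forall>j<i. \<not> a j v then 1 else 0) * g (v i) \<partial>P) = reach a i * (\<integral>x. g x \<partial>M i)"
    unfolding reach_def by (rule *) (simp_all add: reached_indep[OF a])
qed

lemma integrable_reward:
  assumes a: "online a"
  shows "integrable P (reward a)"
proof -
  have "integrable P (\<lambda>v. (if \<forall>j<i. \<not> a j v then 1 else 0) * (if a i v then v i else 0) :: real)"
    if i: "i < n" for i
  proof (rule Bochner_Integration.integrable_bound[OF integrable_coordinate[OF i integrable_M]])
    have m: "(\<lambda>v. if \<forall>j<i. \<not> a j v then 1 else 0 :: real) \<in> borel_measurable P"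
      using i by (intro borel_measurable_integrable integrable_if_pred measurable_reached[OF a]) simp
    have [measurable]: "Measurable.pred P (a i)"
      using i a by (auto simp: online_def)
    have [measurable]: "(\<lambda>v. v i) \<in> borel_measurable P"
      using borel_measurable_integrable[OF integrable_coordinate[OF i integrable_M]] .
    have "(\<lambda>v. if a i v then v i else 0 :: real) \<in> borel_measurable P" by measurable
    with m show "(\<lambda>v. (if \<forall>j<i. \<not> a j v then 1 else 0) * (if a i v then v i else 0) :: real)
        \<in> borel_measurable P" by (rule borel_measurable_times)
  qed auto
  then show ?thesis
    unfolding reward_def[abs_def] accepted_reward_eq_sum
    by (intro Bochner_Integration.integrable_sum) auto
qed

lemma reach_nonneg: "0 \<le> reach a i"
  unfolding reach_def by (rule Bochner_Integration.integral_nonneg) simp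

lemma low_nonneg: "0 \<le> low a t"
  unfolding low_def by (rule Bochner_Integration.integral_nonneg) simp

lemma reach_mono:
  assumes "online a" "i \<le> k" "k \<le> n"
  shows "reach a k \<le> reach a i"
  unfolding reach_def
  by (intro integral_mono integrable_if_pred measurable_reached) (use assms in auto)

lemma reach_le_1:
  assumes "online a" "i \<le> n"
  shows "reach a i \<le> 1"
  using reach_mono[OF assms(1), of 0 i] assms(2) by (simp add: reach_def P.prob_space)

lemma measurable_reward_le:
  assumes "online a"
  shows "Measurable.pred P (\<lambda>v. reward a v \<le> t)"
  using borel_measurable_integrable[OF integrable_reward[OF assms]] by measurable

section \<open>What an online rule can earn, and when it must end low\<close>

text \<open>Pointwise, an accepted reward is at most \<open>t\<close> plus its excess over
  \<open>t\<close>, that excess is one of those at the reached steps, and a reward of at most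
  \<open>l\<close> falls short of \<open>t\<close> by \<open>t - l\<close>. Choosing
  \<open>l = t\<close> removes the shortfall term.\<close>

lemma reward_upper_bound:
  assumes a: "online a" and "l \<le> t" "0 \<le> t"
  shows "integral\<^sup>L P (reward a) \<le> t - (t - l) * low a l + (\<Sum>i<n. reach a i * excess (M i) t)"
proof -
  define r :: "nat \<Rightarrow> (nat \<Rightarrow> real) \<Rightarrow> real" where "r i v = (if \<forall>j<i. \<not> a j v then 1 else 0)" for i v
  have r0: "0 \<le> r i v" for i v by (simp add: r_def)
  have pw: "reward a v \<le> t - (t - l) * (if reward a v \<le> l then 1 else 0)
      + (\<Sum>i<n. r i v * max 0 (v i - t))" for v
  proof -
    have s: "0 \<le> (\<Sum>i<n. r i v * max 0 (v i - t))"
      by (intro sum_nonneg mult_nonneg_nonneg r0) simp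
    show ?thesis
    proof (cases "\<exists>i<n. a i v")
      case True
      define m where "m = (LEAST i. a i v)"
      have m: "m < n" "\<And>j. j < m \<Longrightarrow> \<not> a j v"
        using True Least_le[of "\<lambda>i. a i v"] not_less_Least[of _ "\<lambda>i. a i v"] unfolding m_def
        by (meson le_less_trans, blast)
      have "r m v * max 0 (v m - t) \<le> (\<Sum>i<n. r i v * max 0 (v i - t))"
        by (rule member_le_sum) (use m r0 in auto)
      moreover have "r m v = 1" using m by (simp add: r_def)
      moreover have "reward a v = v m" using True by (simp add: reward_def accepted_reward_def m_def)
      ultimately show ?thesis using s assms by auto
    next
      case False
      then have "reward a v = 0" by (auto simp: reward_def accepted_reward_def)
      then show ?thesis using s assms by auto
    qed
  qed
  have i1: "integrable P (\<lambda>v. if reward a v \<le> l then 1 else 0 :: real)"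
    by (rule integrable_if_pred[OF measurable_reward_le[OF a]])
  have i2: "integrable P (\<lambda>v. r i v * max 0 (v i - t))"
    and e2: "(\<integral>v. r i v * max 0 (v i - t) \<partial>P) = reach a i * excess (M i) t" if "i < n" for i
    using integral_reached_times[OF a that integrable_excess[OF prob integrable_M]]
    by (auto simp: r_def excess_def)
  have "integral\<^sup>L P (reward a) \<le> (\<integral>v. t - (t - l) * (if reward a v \<le> l then 1 else 0)
      + (\<Sum>i<n. r i v * max 0 (v i - t)) \<partial>P)"
    by (intro integral_mono integrable_reward a pw Bochner_Integration.integrable_add
        Bochner_Integration.integrable_diff integrable_mult_right i1
        Bochner_Integration.integrable_sum i2) auto
  also have "\<dots> = t - (t - l) * low a l + (\<Sum>i<n. reach a i * excess (M i) t)"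
  proof (subst Bochner_Integration.integral_add)
    show "integrable P (\<lambda>v. t - (t - l) * (if reward a v \<le> l then 1 else 0))"
      "integrable P (\<lambda>v. \<Sum>i<n. r i v * max 0 (v i - t))"
      using i1 i2 by (auto intro!: Bochner_Integration.integrable_sum)
    show "(\<integral>v. t - (t - l) * (if reward a v \<le> l then 1 else 0) \<partial>P)
        + (\<integral>v. (\<Sum>i<n. r i v * max 0 (v i - t)) \<partial>P)
        = t - (t - l) * low a l + (\<Sum>i<n. reach a i * excess (M i) t)"
      using i1 by (simp add: i2 e2 low_def P.prob_space)
  qed
  finally show ?thesis .
qed

lemma integral_indicator_block:
  assumes "i \<le> n"
  shows "(\<integral>v. (\<Prod>k\<in>{i..<n}. if v k \<le> t k then 1 else 0) \<partial>P) = (\<Prod>k\<in>{i..<n}. measure (M k) {..t k})"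
    and "(\<integral>v. (\<Prod>k<i. if v k \<le> t k then 1 else 0) \<partial>P) = (\<Prod>k<i. measure (M k) {..t k})"
proof -
  have *: "(\<integral>v. (\<Prod>k\<in>A. if v k \<le> t k then 1 else 0) \<partial>P) = (\<Prod>k\<in>A. measure (M k) {..t k})"
    if A: "A \<subseteq> {..<n}" for A
  proof -
    \<comment> \<open>The factor 1 outside \<open>A\<close> extends the product to all coordinates,
      where independence factors the integral.\<close>
    define f :: "nat \<Rightarrow> real \<Rightarrow> real" where "f k = (if k \<in> A then indicator {..t k} else (\<lambda>_. 1))" for k
    have int: "integrable (M k) (f k)" for k
      by (auto simp: f_def sets_M M.emeasure_eq_measure)
    have "(\<Prod>k\<in>A. if v k \<le> t k then 1 else 0) = (\<Prod>k<n. f k (v k))" for v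
      by (rule prod.mono_neutral_cong_left) (use A in \<open>auto simp: f_def indicator_def\<close>)
    moreover have "(\<Prod>k<n. integral\<^sup>L (M k) (f k)) = (\<Prod>k\<in>A. measure (M k) {..t k})"
      by (rule prod.mono_neutral_cong_right)
        (use A in \<open>auto simp: f_def sets_M M.prob_space\<close>)
    ultimately show ?thesis
      using product_integral_prod[of "{..<n}" f] int by simp
  qed
  show "(\<integral>v. (\<Prod>k\<in>{i..<n}. if v k \<le> t k then 1 else 0) \<partial>P) = (\<Prod>k\<in>{i..<n}. measure (M k) {..t k})"
    by (rule *) auto
  show "(\<integral>v. (\<Prod>k<i. if v k \<le> t k then 1 else 0) \<partial>P) = (\<Prod>k<i. measure (M k) {..t k})"
    by (rule *) (use assms in auto)
qed

text \<open>If the rule is still running at step \<open>i\<close> and all later rewards are at most \<open>l\<close>, it ends low.\<close>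

lemma block_below_le:
  assumes a: "online a" and "0 \<le> l" "i \<le> n"
  shows "(\<Prod>k\<in>{i..<n}. measure (M k) {..l}) \<le> (1 - reach a i) + low a l"
proof -
  have "(\<Prod>k\<in>{i..<n}. measure (M k) {..l}) = (\<integral>v. (\<Prod>k\<in>{i..<n}. if v k \<le> l then 1 else 0) \<partial>P)"
    using integral_indicator_block(1)[OF assms(3), of "\<lambda>_. l"] by simp
  also have "\<dots> \<le> (\<integral>v. (1 - (if \<forall>j<i. \<not> a j v then 1 else 0)) + (if reward a v \<le> l then 1 else 0) \<partial>P)"
  proof (rule Bochner_Integration.integral_mono)
    have [measurable]: "(\<lambda>v. v k) \<in> borel_measurable P" if "k \<in> {i..<n}" for k
      using borel_measurable_integrable[OF integrable_coordinate[OF _ integrable_M]] that by simp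
    show "integrable P (\<lambda>v. \<Prod>k\<in>{i..<n}. if v k \<le> l then 1 else 0 :: real)"
      by (rule integrable_const_bound[where B = 1]) (auto simp: abs_prod intro!: prod_le_1)
    show "integrable P (\<lambda>v. (1 - (if \<forall>j<i. \<not> a j v then 1 else 0))
        + (if reward a v \<le> l then 1 else 0) :: real)"
      by (intro Bochner_Integration.integrable_add Bochner_Integration.integrable_diff
          integrable_if_pred measurable_reached measurable_reward_le) (use assms in auto)
    show "(\<Prod>k\<in>{i..<n}. if v k \<le> l then 1 else 0) \<le>
        (1 - (if \<forall>j<i. \<not> a j v then 1 else 0)) + (if reward a v \<le> l then 1 else 0 :: real)" for v
    proof (cases "(\<forall>j<i. \<not> a j v) \<and> (\<forall>k\<in>{i..<n}. v k \<le> l)")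
      case True
      \<comment> \<open>A rule still running can only stop at one of the small rewards or end with
        0, and \<open>0 \<le> l\<close> covers the latter.\<close>
      have "reward a v \<le> l"
      proof (cases "\<exists>k<n. a k v")
        case True
        define m where "m = (LEAST k. a k v)"
        have "a m v" "m < n"
          using True LeastI_ex[of "\<lambda>i. a i v"] Least_le[of "\<lambda>i. a i v"] unfolding m_def
          by (blast, meson le_less_trans)
        moreover have "reward a v = v m"
          using True by (simp add: reward_def accepted_reward_def m_def)
        ultimately show ?thesis
          using \<open>(\<forall>j<i. \<not> a j v) \<and> _\<close> by (metis atLeastLessThan_iff not_le)
      qed (use \<open>0 \<le> l\<close> in \<open>auto simp: reward_def accepted_reward_def\<close>)
      then show ?thesis using True by simp
    next
      case False
      have p1: "(\<Prod>k\<in>{i..<n}. if v k \<le> l then 1 else 0 :: real) \<le> 1" by (intro prod_le_1) auto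
      show ?thesis
      proof (cases "\<forall>j<i. \<not> a j v")
        case True
        then have "(\<Prod>k\<in>{i..<n}. if v k \<le> l then 1 else 0 :: real) = 0"
          using False by (intro prod_zero) auto
        then show ?thesis by (simp only: True) auto
      qed (use p1 in auto)
    qed
  qed
  also have "\<dots> = (1 - reach a i) + low a l"
    using integrable_if_pred[OF measurable_reward_le[OF a]]
      integrable_if_pred[OF measurable_reached[OF a assms(3)]]
    by (simp add: reach_def low_def P.prob_space)
  finally show ?thesis .
qed

section \<open>Earnings of threshold rules\<close>

lemma online_threshold: "online (\<lambda>i v. \<theta> i < v i)"
proof -
  have "Measurable.pred P (\<lambda>v. \<theta> i < v i)" if "i < n" for i
    using borel_measurable_integrable[OF integrable_coordinate[OF that integrable_M]] by measurable
  then show ?thesis by (auto simp: online_def)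
qed

text \<open>A step is reached exactly when no earlier reward exceeded its threshold, which by
  independence has a product probability.\<close>

lemma threshold_reward:
  "integral\<^sup>L P (reward (\<lambda>i v. \<theta> i < v i)) =
     (\<Sum>i<n. (\<Prod>k<i. measure (M k) {..\<theta> k}) *
        (\<theta> i * (1 - measure (M i) {..\<theta> i}) + excess (M i) (\<theta> i)))"
proof -
  let ?a = "\<lambda>i v. \<theta> i < v i"
  note gi = integral_above_threshold[OF prob sets_M integrable_M]
  have re: "reach ?a i = (\<Prod>k<i. measure (M k) {..\<theta> k})" if "i < n" for i
  proof -
    have "(\<Prod>k<i. if v k \<le> \<theta> k then 1 else 0) = (if \<forall>j<i. \<not> \<theta> j < v j then 1 else 0 :: real)" for v
    proof (cases "\<forall>j<i. \<not> \<theta> j < v j")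
      case False
      then obtain j where "j < i" "\<theta> j < v j" by auto
      then have "(\<Prod>k<i. if v k \<le> \<theta> k then 1 else 0 :: real) = 0"
        by (intro prod_zero bexI[of _ j]) auto
      then show ?thesis by (simp only: False if_False)
    qed (auto intro!: prod.neutral)
    then show ?thesis
      using integral_indicator_block(2)[of i \<theta>] that by (simp only: reach_def less_imp_le)
  qed
  have "integral\<^sup>L P (reward ?a) = (\<Sum>i<n. \<integral>v. (if \<forall>j<i. \<not> \<theta> j < v j then 1 else 0)
      * (if \<theta> i < v i then v i else 0) \<partial>P)"
    unfolding reward_def[abs_def] accepted_reward_eq_sum
    by (rule Bochner_Integration.integral_sum)
      (rule integral_reached_times(1)[OF online_threshold _ gi(1)], simp)
  also have "\<dots> = (\<Sum>i<n. reach ?a i * (\<theta> i * (1 - measure (M i) {..\<theta> i}) + excess (M i) (\<theta> i)))"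
    by (intro sum.cong refl) (subst integral_reached_times(2)[OF online_threshold _ gi(1)], auto simp: gi(2))
  also have "\<dots> = (\<Sum>i<n. (\<Prod>k<i. measure (M k) {..\<theta> k}) *
        (\<theta> i * (1 - measure (M i) {..\<theta> i}) + excess (M i) (\<theta> i)))"
    by (intro sum.cong refl) (simp only: re lessThan_iff)
  finally show ?thesis .
qed

lemma excess_M_antimono: "s \<le> t \<Longrightarrow> excess (M i) t \<le> excess (M i) s"
  by (rule excess_antimono[OF prob integrable_M])

lemma prod_below_bounds:
  "0 \<le> (\<Prod>k\<in>A. measure (M k) {..\<theta> k})" "(\<Prod>k\<in>A. measure (M k) {..\<theta> k}) \<le> 1"
  by (auto intro!: prod_nonneg prod_le_1)

text \<open>Let \<open>Q n\<close> be the probability of accepting nothing. Stopping pays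
  \<open>\<tau>\<close> with probability \<open>1 - Q n\<close>, and every excess is met with
  probability at least \<open>Q n\<close>, which makes up for the missing
  \<open>Q n * \<tau>\<close>.\<close>

lemma single_threshold_reward:
  assumes "0 \<le> \<tau>" "\<tau> \<le> (\<Sum>i<n. excess (M i) \<tau>)"
  shows "\<tau> \<le> integral\<^sup>L P (reward (\<lambda>i v. \<tau> < v i))"
proof -
  define Q where "Q i = (\<Prod>k<i. measure (M k) {..\<tau>})" for i
  have tel: "(\<Sum>i<n. Q i * (1 - measure (M i) {..\<tau>})) = 1 - Q n"
    unfolding Q_def by (rule sum_survival)
  have "Q n * \<tau> \<le> (\<Sum>i<n. Q i * excess (M i) \<tau>)"
  proof -
    have "Q n * \<tau> \<le> Q n * (\<Sum>i<n. excess (M i) \<tau>)"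
      using assms prod_below_bounds[of "\<lambda>_. \<tau>"] by (auto intro: mult_left_mono simp: Q_def)
    also have "\<dots> \<le> (\<Sum>i<n. Q i * excess (M i) \<tau>)"
      unfolding sum_distrib_left Q_def
      by (intro sum_mono mult_right_mono excess_nonneg prod_antimono_subset) auto
    finally show ?thesis .
  qed
  moreover have "integral\<^sup>L P (reward (\<lambda>i v. \<tau> < v i))
      = \<tau> * (1 - Q n) + (\<Sum>i<n. Q i * excess (M i) \<tau>)"
    unfolding threshold_reward tel[symmetric]
    by (simp add: Q_def sum_distrib_left algebra_simps flip: sum.distrib)
  ultimately show ?thesis by (simp add: algebra_simps)
qed

text \<open>With probability \<open>1 - Q\<close> the rule stops before step \<open>t\<close> and is
  paid at least \<open>K\<close>; each early excess is met with probability at least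
  \<open>Q\<close>. From \<open>t\<close> on the threshold is \<open>L\<close>, and the excess over
  \<open>L\<close> dominates the one over \<open>K\<close>. The bound is a mixture of
  \<open>K\<close> and a bracket with weights \<open>1 - Q\<close> and \<open>Q\<close>.\<close>

lemma switching_threshold_reward:
  fixes t K L
  defines "Q \<equiv> \<Prod>k<t. measure (M k) {..K}"
  assumes t: "t \<le> n" and L: "L \<le> K"
  shows "K * (1 - Q) + Q * (L * (1 - (\<Prod>k\<in>{t..<n}. measure (M k) {..L})) + (\<Sum>i<t. excess (M i) K)
            + (\<Sum>m\<in>{t..<n}. (\<Prod>k\<in>{t..<m}. measure (M k) {..L}) * excess (M m) K))
    \<le> integral\<^sup>L P (reward (\<lambda>i v. (if i < t then K else L) < v i))"
proof -
  define \<theta> where "\<theta> i = (if i < t then K else L)" for i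
  define C where "C i = (\<Prod>k\<in>{t..<i}. measure (M k) {..L})" for i
  define R where "R i = (\<Prod>k<i. measure (M k) {..\<theta> k})" for i
  define u where "u i = \<theta> i * (1 - measure (M i) {..\<theta> i}) + excess (M i) (\<theta> i)" for i
  have Rt: "R t = Q" unfolding R_def Q_def by (intro prod.cong) (auto simp: \<theta>_def)
  have Q0: "0 \<le> Q" unfolding Q_def by (rule prod_below_bounds)
  have C0: "0 \<le> C i" for i unfolding C_def by (rule prod_below_bounds)
  have early: "K * (1 - Q) + Q * (\<Sum>i<t. excess (M i) K) \<le> (\<Sum>i<t. R i * u i)"
  proof -
    have "K * (1 - Q) = K * (\<Sum>i<t. R i * (1 - measure (M i) {..K}))"
    proof -
      have "(\<Sum>i<t. R i * (1 - measure (M i) {..K}))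
          = (\<Sum>i<t. (\<Prod>k<i. measure (M k) {..K}) * (1 - measure (M i) {..K}))"
        unfolding R_def by (intro sum.cong prod.cong arg_cong2[where f = "(*)"]) (auto simp: \<theta>_def)
      then show ?thesis by (simp add: sum_survival Q_def)
    qed
    moreover have "Q * (\<Sum>i<t. excess (M i) K) \<le> (\<Sum>i<t. R i * excess (M i) K)"
      unfolding sum_distrib_left Rt[symmetric] R_def
      by (intro sum_mono mult_right_mono excess_nonneg prod_antimono_subset) auto
    moreover have "(\<Sum>i<t. R i * u i)
        = K * (\<Sum>i<t. R i * (1 - measure (M i) {..K})) + (\<Sum>i<t. R i * excess (M i) K)"
      unfolding sum_distrib_left sum.distrib[symmetric]
      by (intro sum.cong) (auto simp: u_def \<theta>_def algebra_simps)
    ultimately show ?thesis by linarith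
  qed
  have late: "Q * (L * (1 - C n) + (\<Sum>m\<in>{t..<n}. C m * excess (M m) K)) \<le> (\<Sum>i\<in>{t..<n}. R i * u i)"
  proof -
    have Ri: "R i = Q * C i" if "i \<in> {t..<n}" for i
    proof -
      have "{..<i} = {..<t} \<union> {t..<i}" using that by auto
      then have "R i = R t * (\<Prod>k\<in>{t..<i}. measure (M k) {..\<theta> k})"
        unfolding R_def by (simp add: prod.union_disjoint ivl_disj_int)
      also have "(\<Prod>k\<in>{t..<i}. measure (M k) {..\<theta> k}) = C i"
        unfolding C_def by (intro prod.cong) (auto simp: \<theta>_def)
      finally show ?thesis by (simp add: Rt)
    qed
    have "1 - C n = (\<Sum>i\<in>{t..<n}. C i * (1 - measure (M i) {..L}))"
      unfolding C_def by (rule sum_survival_from[OF t, symmetric])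
    then have "Q * (L * (1 - C n) + (\<Sum>m\<in>{t..<n}. C m * excess (M m) K))
        = Q * (L * (\<Sum>i\<in>{t..<n}. C i * (1 - measure (M i) {..L}))
          + (\<Sum>m\<in>{t..<n}. C m * excess (M m) K))"
      by (simp only:)
    also have "\<dots> = (\<Sum>i\<in>{t..<n}. Q * (C i * (L * (1 - measure (M i) {..L}) + excess (M i) K)))"
      by (simp add: sum_distrib_left algebra_simps flip: sum.distrib)
    also have "\<dots> \<le> (\<Sum>i\<in>{t..<n}. R i * u i)"
    proof (rule sum_mono)
      fix i assume i: "i \<in> {t..<n}"
      then have "L * (1 - measure (M i) {..L}) + excess (M i) K \<le> u i"
        using excess_M_antimono[OF L] by (simp add: u_def \<theta>_def)
      then have "Q * (C i * (L * (1 - measure (M i) {..L}) + excess (M i) K)) \<le> Q * (C i * u i)"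
        by (intro mult_left_mono Q0 C0)
      then show "Q * (C i * (L * (1 - measure (M i) {..L}) + excess (M i) K)) \<le> R i * u i"
        by (simp add: Ri[OF i])
    qed
    finally show ?thesis .
  qed
  have "integral\<^sup>L P (reward (\<lambda>i v. \<theta> i < v i)) = (\<Sum>i<n. R i * u i)"
    unfolding threshold_reward R_def u_def ..
  also have "\<dots> = (\<Sum>i<t. R i * u i) + (\<Sum>i\<in>{t..<n}. R i * u i)"
  proof -
    have "{..<n} = {..<t} \<union> {t..<n}" using t by auto
    then show ?thesis by (simp add: sum.union_disjoint ivl_disj_int)
  qed
  finally show ?thesis
    using early late unfolding \<theta>_def[symmetric] C_def[symmetric] by (simp add: algebra_simps)
qed

section \<open>Orders with a near-optimal rule, and the switching rule\<close>

text \<open>The first claim is \<open>reward_upper_bound\<close> at \<open>t = 11/10 \<tau>\<close>.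
  At \<open>t = \<tau>\<close> that bound shows that shortfalls and excesses missed by stopping
  early cost together at most \<open>2/100000 \<tau>\<close>. Hence ending with at most
  \<open>99/100 \<tau>\<close> has probability at most 2/1000, and having stopped while
  \<open>5/100 \<tau>\<close> of excess remains at most 4/10000; \<open>block_below_le\<close> adds
  the two.\<close>

lemma near_optimal_structure:
  assumes \<tau>: "0 < \<tau>" "(\<Sum>i<n. excess (M i) \<tau>) = \<tau>"
    and a: "online a" and good: "199998 / 100000 * \<tau> < integral\<^sup>L P (reward a)"
  shows "89 / 100 * \<tau> \<le> (\<Sum>i<n. excess (M i) (11 / 10 * \<tau>))"
    and "i \<le> n \<Longrightarrow> 5 / 100 * \<tau> \<le> (\<Sum>k\<in>{i..<n}. excess (M k) (11 / 10 * \<tau>)) \<Longrightarrow>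
      (\<Prod>k\<in>{i..<n}. measure (M k) {..99 / 100 * \<tau>}) \<le> 3 / 1000"
proof -
  have "integral\<^sup>L P (reward a) \<le> 11 / 10 * \<tau> + (\<Sum>i<n. reach a i * excess (M i) (11 / 10 * \<tau>))"
    using reward_upper_bound[OF a order.refl, of "11 / 10 * \<tau>"] \<tau> by simp
  also have "(\<Sum>i<n. reach a i * excess (M i) (11 / 10 * \<tau>)) \<le> (\<Sum>i<n. excess (M i) (11 / 10 * \<tau>))"
    by (intro sum_mono mult_left_le_one_le excess_nonneg reach_nonneg reach_le_1[OF a]) auto
  finally show "89 / 100 * \<tau> \<le> (\<Sum>i<n. excess (M i) (11 / 10 * \<tau>))"
    using good \<tau> by simp
  assume i: "i \<le> n" and w: "5 / 100 * \<tau> \<le> (\<Sum>k\<in>{i..<n}. excess (M k) (11 / 10 * \<tau>))"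
  have loss: "\<tau> / 100 * low a (99 / 100 * \<tau>) + (\<Sum>k<n. (1 - reach a k) * excess (M k) \<tau>)
      \<le> 2 / 100000 * \<tau>"
  proof -
    have "(\<Sum>k<n. (1 - reach a k) * excess (M k) \<tau>) = \<tau> - (\<Sum>k<n. reach a k * excess (M k) \<tau>)"
      by (simp add: left_diff_distrib sum_subtractf \<tau>(2))
    then show ?thesis
      using reward_upper_bound[OF a, of "99 / 100 * \<tau>" \<tau>] \<tau>(1) good by (simp add: algebra_simps)
  qed
  have nn: "0 \<le> (1 - reach a k) * excess (M k) \<tau>" if "k < n" for k
    using reach_le_1[OF a, of k] that by (intro mult_nonneg_nonneg excess_nonneg) auto
  \<comment> \<open>As \<open>reach\<close> decreases, every step from \<open>i\<close> on is missed
    with at least the probability of having stopped before \<open>i\<close>.\<close>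
  have "(1 - reach a i) * (5 / 100 * \<tau>) \<le> (1 - reach a i) * (\<Sum>k\<in>{i..<n}. excess (M k) (11 / 10 * \<tau>))"
    using reach_le_1[OF a i] by (intro mult_left_mono w) auto
  also have "\<dots> \<le> (\<Sum>k\<in>{i..<n}. (1 - reach a k) * excess (M k) \<tau>)"
    unfolding sum_distrib_left
    using reach_mono[OF a] reach_le_1[OF a] \<tau>(1)
    by (intro sum_mono mult_mono excess_M_antimono excess_nonneg) auto
  also have "\<dots> \<le> (\<Sum>k<n. (1 - reach a k) * excess (M k) \<tau>)"
    by (rule sum_mono2) (use nn in auto)
  finally have r: "(1 - reach a i) * (5 / 100 * \<tau>) \<le> (\<Sum>k<n. (1 - reach a k) * excess (M k) \<tau>)" .
  have "0 \<le> (\<Sum>k<n. (1 - reach a k) * excess (M k) \<tau>)" by (rule sum_nonneg) (use nn in auto)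
  moreover have "0 \<le> \<tau> / 100 * low a (99 / 100 * \<tau>)" using low_nonneg \<tau>(1) by simp
  ultimately have "\<tau> * (low a (99 / 100 * \<tau>) / 100) \<le> \<tau> * (2 / 100000)"
    "\<tau> * ((1 - reach a i) * 5 / 100) \<le> \<tau> * (2 / 100000)"
    using loss r by (simp_all add: algebra_simps)
  then have "low a (99 / 100 * \<tau>) / 100 \<le> 2 / 100000" "(1 - reach a i) * 5 / 100 \<le> 2 / 100000"
    using \<tau>(1) by (simp_all only: mult_le_cancel_left_pos)
  then show "(\<Prod>k\<in>{i..<n}. measure (M k) {..99 / 100 * \<tau>}) \<le> 3 / 1000"
    using block_below_le[OF a _ i, of "99 / 100 * \<tau>"] \<tau>(1) by simp
qed

text \<open>Both criteria depend only on which boxes came before step \<open>i\<close> and which are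
  still to come, not on their order or rewards, so past identities determine them. The product
  bounds from below the probability of reaching box \<open>j\<close> under the lower threshold,
  wherever it stands among the remaining boxes.\<close>

definition switch :: "real \<Rightarrow> nat \<Rightarrow> bool" where
  "switch \<tau> i \<longleftrightarrow> 4 / 100 * \<tau> \<le> (\<Sum>k<i. excess (M k) (11 / 10 * \<tau>)) \<or>
     (\<exists>j\<in>{i..<n}. 5 / 100 * \<tau> \<le> excess (M j) (11 / 10 * \<tau>) \<and>
        7 / 10 < (\<Prod>k\<in>{i..<n} - {j}. measure (M k) {..99 / 100 * \<tau>}))"

text \<open>Quantifying over \<open>s \<le> i\<close> makes the change permanent: the second
  criterion may fail again once its box \<open>j\<close> has passed.\<close>

definition switching_rule :: "real \<Rightarrow> nat \<Rightarrow> (nat \<Rightarrow> real) \<Rightarrow> bool" where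
  "switching_rule \<tau> i v \<longleftrightarrow> (if \<exists>s\<le>i. switch \<tau> s then 99 / 100 * \<tau> else 11 / 10 * \<tau>) < v i"

text \<open>By \<open>switching_threshold_reward\<close> the expected reward is at least a mixture
  of \<open>11/10 \<tau>\<close> and a bracket, so it suffices that the bracket reaches
  \<open>102/100 \<tau>\<close>. The cases are which criterion holds at the first switch and how
  much excess is left then.\<close>

lemma switching_rule_reward:
  assumes \<tau>: "0 < \<tau>" "(\<Sum>i<n. excess (M i) \<tau>) = \<tau>"
    and a: "online a" and good: "199998 / 100000 * \<tau> < integral\<^sup>L P (reward a)"
  shows "102 / 100 * \<tau> \<le> integral\<^sup>L P (reward (switching_rule \<tau>))"
proof -
  define w where "w k = excess (M k) (11 / 10 * \<tau>)" for k
  define c where "c k = measure (M k) {..99 / 100 * \<tau>}" for k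
  define C where "C i j = (\<Prod>k\<in>{i..<j}. c k)" for i j
  note near = near_optimal_structure[OF \<tau> a good, folded w_def c_def]
  have w0: "0 \<le> w k" for k by (simp add: w_def excess_nonneg)
  have c01: "0 \<le> c k" "c k \<le> 1" for k by (simp_all add: c_def)
  have C0: "0 \<le> C i j" for i j unfolding C_def by (rule prod_nonneg) (simp add: c01)
  have sw: "switch \<tau> i \<longleftrightarrow> 4 / 100 * \<tau> \<le> sum w {..<i} \<or>
     (\<exists>j\<in>{i..<n}. 5 / 100 * \<tau> \<le> w j \<and> 7 / 10 < prod c ({i..<n} - {j}))" for i
    by (simp add: switch_def w_def c_def)
  define t where "t = (LEAST i. switch \<tau> i)"
  \<comment> \<open>After the last box all the excess has passed and the first criterion holds, so
    the first switch \<open>t\<close> exists and is at most \<open>n\<close>.\<close>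
  have "switch \<tau> n" using near(1) \<tau>(1) by (simp add: sw)
  then have t: "switch \<tau> t" "t \<le> n" and t_min: "\<And>s. s < t \<Longrightarrow> \<not> switch \<tau> s"
    unfolding t_def by (auto intro: LeastI Least_le dest: not_less_Least)
  have rule: "switching_rule \<tau> = (\<lambda>i v. (if i < t then 11 / 10 * \<tau> else 99 / 100 * \<tau>) < v i)"
  proof -
    have "(\<exists>s\<le>i. switch \<tau> s) \<longleftrightarrow> \<not> i < t" for i
      using t t_min by (meson le_less_trans not_le)
    then show ?thesis by (simp add: switching_rule_def fun_eq_iff)
  qed
  have split: "sum w {..<n} = sum w {..<i} + sum w {i..<n}" if "i \<le> n" for i
  proof -
    have "{..<n} = {..<i} \<union> {i..<n}" using that by auto
    then show ?thesis by (simp add: sum.union_disjoint ivl_disj_int)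
  qed
  have Cw0: "0 \<le> (\<Sum>m\<in>{t..<n}. C t m * w m)"
    by (intro sum_nonneg mult_nonneg_nonneg C0 w0)
  have sw0: "0 \<le> sum w {..<t}" by (rule sum_nonneg) (simp add: w0)
  have bracket: "102 / 100 * \<tau> \<le> 99 / 100 * \<tau> * (1 - C t n) + sum w {..<t} + (\<Sum>m\<in>{t..<n}. C t m * w m)"
  proof (cases "4 / 100 * \<tau> \<le> sum w {..<t}")
    case gone: True
    show ?thesis
    proof (cases "5 / 100 * \<tau> \<le> sum w {t..<n}")
      case True
      \<comment> \<open>Much excess is left, so a reward above \<open>99/100 \<tau>\<close> is
        nearly certain: 0.99 * 0.997 + 0.04 > 1.02.\<close>
      then have "C t n \<le> 3 / 1000" using near(2)[OF t(2)] by (simp add: C_def)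
      then have "99 / 100 * \<tau> * (997 / 1000) \<le> 99 / 100 * \<tau> * (1 - C t n)"
        using \<tau>(1) by (intro mult_left_mono) auto
      then show ?thesis using gone Cw0 \<tau>(1) by linarith
    next
      case False
      \<comment> \<open>Little excess is left, so the single box \<open>s\<close> just before the
        switch carries at least \<open>8/10 \<tau>\<close>. The second criterion failed for it at
        step \<open>s\<close>, so some box after it exceeds \<open>99/100 \<tau>\<close> with
        probability at least 3/10: 0.99 * 0.3 + 0.84 > 1.02.\<close>
      have "t \<noteq> 0" using gone \<tau>(1) by (intro notI) simp
      then obtain s where s: "t = Suc s" by (cases t) auto
      then have ns: "\<not> switch \<tau> s" and sn: "s < n" using t_min t(2) by auto
      have "sum w {..<s} < 4 / 100 * \<tau>" using ns by (simp add: sw)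
      moreover have "sum w {..<t} = sum w {..<s} + w s" by (simp add: s)
      ultimately have "5 / 100 * \<tau> \<le> w s"
        using False near(1) split[OF t(2)] \<tau>(1) by simp
      then have "\<not> 7 / 10 < prod c ({s..<n} - {s})"
        using ns sn by (auto simp: sw)
      moreover have "{s..<n} - {s} = {t..<n}" using s by auto
      ultimately have "C t n \<le> 7 / 10" by (simp add: C_def)
      then have "99 / 100 * \<tau> * (3 / 10) \<le> 99 / 100 * \<tau> * (1 - C t n)"
        using \<tau>(1) by (intro mult_left_mono) auto
      then show ?thesis using False near(1) split[OF t(2)] Cw0 \<tau>(1) by linarith
    qed
  next
    case False
    \<comment> \<open>Only the second criterion holds. Box \<open>j\<close> alone leaves enough
      excess for \<open>C t n \<le> 3/1000\<close>, and its excess is counted with weight at least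
      7/10: 0.99 * 0.997 + 0.7 * 0.05 > 1.02.\<close>
    then obtain j where j: "j \<in> {t..<n}" "5 / 100 * \<tau> \<le> w j" "7 / 10 < prod c ({t..<n} - {j})"
      using t(1) by (auto simp: sw)
    have "w j \<le> sum w {t..<n}" by (rule member_le_sum) (use j w0 in auto)
    then have "C t n \<le> 3 / 1000" using near(2)[OF t(2)] j by (simp add: C_def)
    then have "99 / 100 * \<tau> * (997 / 1000) \<le> 99 / 100 * \<tau> * (1 - C t n)"
      using \<tau>(1) by (intro mult_left_mono) auto
    moreover have "prod c ({t..<n} - {j}) \<le> C t j"
      unfolding C_def by (rule prod_antimono_subset) (use j c01 in auto)
    then have "7 / 10 * (5 / 100 * \<tau>) \<le> C t j * w j"
      using j \<tau>(1) by (intro mult_mono) auto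
    moreover have "C t j * w j \<le> (\<Sum>m\<in>{t..<n}. C t m * w m)"
      by (rule member_le_sum) (use j C0 w0 in auto)
    ultimately show ?thesis using sw0 \<tau>(1) by linarith
  qed
  define Q where "Q = (\<Prod>k<t. measure (M k) {..11 / 10 * \<tau>})"
  have Q: "0 \<le> Q" "Q \<le> 1" unfolding Q_def by (rule prod_below_bounds)+
  have "102 / 100 * \<tau> = 102 / 100 * \<tau> * (1 - Q) + Q * (102 / 100 * \<tau>)" by (simp add: field_simps)
  also have "\<dots> \<le> 11 / 10 * \<tau> * (1 - Q)
      + Q * (99 / 100 * \<tau> * (1 - C t n) + sum w {..<t} + (\<Sum>m\<in>{t..<n}. C t m * w m))"
    using Q \<tau>(1) by (intro add_mono mult_left_mono mult_right_mono bracket) auto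
  also have "\<dots> \<le> integral\<^sup>L P (reward (switching_rule \<tau>))"
    unfolding rule Q_def C_def c_def w_def
    by (rule switching_threshold_reward[OF t(2)]) (use \<tau>(1) in simp)
  finally show ?thesis .
qed

end

section \<open>The balance level of an instance\<close>

text \<open>Fixed by the laws alone, so it is available before any box arrives.\<close>

definition balance_level :: "real measure list \<Rightarrow> real" where
  "balance_level F = (SOME t. 0 < t \<and> (\<Sum>k<length F. excess (F ! k) t) = t)"

lemma valid_instance_nth:
  assumes "valid_instance F" "k < length F"
  shows "prob_space (F ! k)" "sets (F ! k) = sets borel" "AE x in F ! k. 0 \<le> x"
  using assms nth_mem by (auto simp: valid_instance_def)

lemma nn_integral_PiM_coordinate:
  assumes "\<And>i. i \<in> I \<Longrightarrow> prob_space (M i)" "k \<in> I" "g \<in> borel_measurable (M k)"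
  shows "(\<integral>\<^sup>+v. g (v k) \<partial>PiM I M) = (\<integral>\<^sup>+x. g x \<partial>M k)"
proof -
  have "(\<integral>\<^sup>+x. g x \<partial>distr (PiM I M) (M k) (\<lambda>v. v k)) = (\<integral>\<^sup>+v. g (v k) \<partial>PiM I M)"
    by (intro nn_integral_distr measurable_component_singleton) (use assms in auto)
  then show ?thesis using distr_PiM_component[of I M k] assms by simp
qed

lemma valid_instance_nn_integral:
  assumes F: "valid_instance F" and k: "k < length F"
  shows "(\<integral>\<^sup>+v. ennreal (v k) \<partial>PiM {..<length F} (\<lambda>k. F ! k)) = (\<integral>\<^sup>+x. ennreal x \<partial>F ! k)"
proof (rule nn_integral_PiM_coordinate)
  show "ennreal \<in> borel_measurable (F ! k)"
    by (simp add: measurable_cong_sets[OF valid_instance_nth(2)[OF F k] refl])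
qed (use valid_instance_nth[OF F] k in auto)

text \<open>The maximum dominates every coordinate, so its finite mean bounds each mean.\<close>

lemma valid_instance_integrable:
  assumes F: "valid_instance F" and k: "k < length F"
  shows "integrable (F ! k) (\<lambda>x. x)"
proof (rule integrableI_nonneg)
  show "(\<lambda>x. x) \<in> borel_measurable (F ! k)"
    by (simp add: measurable_cong_sets[OF valid_instance_nth(2)[OF F k] refl])
  have "(\<integral>\<^sup>+x. ennreal x \<partial>F ! k) \<le> (\<integral>\<^sup>+x. ennreal (MAX k\<in>{..<length F}. x k) \<partial>PiM {..<length F} (\<lambda>k. F ! k))"
    unfolding valid_instance_nn_integral[OF F k, symmetric]
    by (intro nn_integral_mono ennreal_leI Max_ge) (use k in auto)
  also have "\<dots> < \<infinity>" using F by (auto simp: valid_instance_def Let_def)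
  finally show "(\<integral>\<^sup>+x. ennreal x \<partial>F ! k) < \<infinity>" .
qed (rule valid_instance_nth(3)[OF F k])

text \<open>If all excesses over 0 vanished, so would the mean of the maximum, which is at most the
  sum of the positive parts. This rules out 0 as a balance level.\<close>

lemma valid_instance_excess_pos:
  assumes F: "valid_instance F"
  shows "0 < (\<Sum>k<length F. excess (F ! k) 0)"
proof (rule ccontr)
  assume "\<not> 0 < (\<Sum>k<length F. excess (F ! k) 0)"
  then have "(\<Sum>k<length F. excess (F ! k) 0) = 0"
    using sum_nonneg[of "{..<length F}" "\<lambda>k. excess (F ! k) 0"] excess_nonneg by fastforce
  then have e0: "excess (F ! k) 0 = 0" if "k < length F" for k
    using that by (subst (asm) sum_nonneg_eq_0_iff) (auto simp: excess_nonneg)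
  have z: "(\<integral>\<^sup>+x. ennreal x \<partial>F ! k) = 0" if k: "k < length F" for k
  proof -
    \<comment> \<open>\<open>ennreal\<close> sends negative numbers to 0, so it agrees on
      \<open>x\<close> and on its positive part.\<close>
    have "(\<integral>\<^sup>+x. ennreal x \<partial>F ! k) = (\<integral>\<^sup>+x. ennreal (max 0 (x - 0)) \<partial>F ! k)"
      by (intro nn_integral_cong) (simp add: max_def ennreal_neg)
    also have "\<dots> = ennreal (excess (F ! k) 0)"
      unfolding excess_def
      by (intro nn_integral_eq_integral integrable_excess valid_instance_nth[OF F k]
          valid_instance_integrable[OF F k]) simp
    finally show ?thesis by (simp add: e0[OF k])
  qed
  let ?P = "PiM {..<length F} (\<lambda>k. F ! k)"
  have "(\<integral>\<^sup>+x. ennreal (MAX k\<in>{..<length F}. x k) \<partial>?P) \<le> (\<integral>\<^sup>+x. (\<Sum>k<length F. ennreal (x k)) \<partial>?P)"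
  proof (rule nn_integral_mono)
    fix x :: "nat \<Rightarrow> real"
    have "(MAX k\<in>{..<length F}. x k) \<in> x ` {..<length F}"
      using F by (intro Max_in) (auto simp: valid_instance_def lessThan_empty_iff)
    then obtain k where k: "k < length F" "(MAX k\<in>{..<length F}. x k) = x k" by auto
    then show "ennreal (MAX k\<in>{..<length F}. x k) \<le> (\<Sum>k<length F. ennreal (x k))"
      by (auto intro!: member_le_sum)
  qed
  also have "\<dots> = (\<Sum>k<length F. \<integral>\<^sup>+x. ennreal (x k) \<partial>?P)"
  proof (rule nn_integral_sum)
    fix k assume k: "k \<in> {..<length F}"
    then have "(\<lambda>x. x k) \<in> borel_measurable ?P"
      using measurable_component_singleton[OF k, of "\<lambda>k. F ! k"]
        measurable_cong_sets[OF refl valid_instance_nth(2)[OF F], of k ?P] by simp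
    then show "(\<lambda>x. ennreal (x k)) \<in> borel_measurable ?P" by simp
  qed
  also have "\<dots> = 0" using valid_instance_nn_integral[OF F] z by simp
  finally show False using F by (auto simp: valid_instance_def Let_def)
qed

text \<open>Intermediate value theorem for \<open>g\<close> on \<open>[0, T]\<close>, with
  \<open>T\<close> the total excess over 0: \<open>g 0 = - T < 0\<close>, while
  \<open>g T \<ge> 0\<close> because the excess decreases in the threshold.\<close>

lemma balance_level:
  assumes F: "valid_instance F"
  shows "0 < balance_level F" "(\<Sum>k<length F. excess (F ! k) (balance_level F)) = balance_level F"
proof -
  define T where "T = (\<Sum>k<length F. excess (F ! k) 0)"
  define g where "g t = t - (\<Sum>k<length F. excess (F ! k) t)" for t
  have T: "0 < T" unfolding T_def by (rule valid_instance_excess_pos[OF F])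
  have "continuous_on {0..T} (excess (F ! k))" if k: "k < length F" for k
  proof -
    have "\<bar>excess (F ! k) t - excess (F ! k) s\<bar> \<le> \<bar>t - s\<bar>" for s t
      by (intro excess_lipschitz valid_instance_nth[OF F k] valid_instance_integrable[OF F k])
    then show ?thesis by (auto simp: continuous_on_iff dist_real_def intro: le_less_trans)
  qed
  then have "continuous_on {0..T} g" unfolding g_def by (intro continuous_intros) auto
  moreover have "(\<Sum>k<length F. excess (F ! k) T) \<le> T"
    unfolding T_def[symmetric] using T
    by (subst (2) T_def) (intro sum_mono excess_antimono valid_instance_nth[OF F]
        valid_instance_integrable[OF F], auto)
  then have "0 \<le> g T" by (simp add: g_def)
  moreover have "g 0 \<le> 0" using T by (simp add: g_def T_def)
  ultimately obtain t where t: "0 \<le> t" "g t = 0" using IVT'[of g 0 0 T] T by auto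
  then have "0 < t \<and> (\<Sum>k<length F. excess (F ! k) t) = t"
    using T by (cases "t = 0") (auto simp: g_def T_def)
  then have "0 < balance_level F \<and>
      (\<Sum>k<length F. excess (F ! k) (balance_level F)) = balance_level F"
    unfolding balance_level_def by (rule someI)
  then show "0 < balance_level F" "(\<Sum>k<length F. excess (F ! k) (balance_level F)) = balance_level F"
    by auto
qed

section \<open>The randomized algorithm\<close>

text \<open>The form of \<open>switch\<close> in terms of box identities instead of steps;
  \<open>switch_after_eq\<close> matches the two.\<close>

definition switch_after :: "real measure list \<Rightarrow> nat list \<Rightarrow> bool" where
  "switch_after F ids \<longleftrightarrow> (let \<tau> = balance_level F; B = {..<length F} - set ids in
     4 / 100 * \<tau> \<le> (\<Sum>k\<in>set ids. excess (F ! k) (11 / 10 * \<tau>)) \<or>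
     (\<exists>j\<in>B. 5 / 100 * \<tau> \<le> excess (F ! j) (11 / 10 * \<tau>) \<and>
        7 / 10 < (\<Prod>k\<in>B - {j}. measure (F ! k) {..99 / 100 * \<tau>})))"

text \<open>The prefixes of \<open>ids\<close> are the histories of all earlier steps, so whether
  the rule has already switched is recovered without memory.\<close>

definition threshold :: "real measure list \<Rightarrow> real \<Rightarrow> nat list \<Rightarrow> real" where
  "threshold F u ids = (let \<tau> = balance_level F in
     if u = 0 then \<tau>
     else if \<exists>s\<le>length ids. switch_after F (take s ids) then 99 / 100 * \<tau>
     else 11 / 10 * \<tau>)"

text \<open>The weight \<open>p\<close> of the switching rule is a compromise: \<open>1 - p\<close>
  must exceed half of 1.99998, so \<open>p\<close> is below 1/10^5, while
  \<open>1 + p * 2/100\<close> must reach \<open>1 + 2/10^8\<close>, so \<open>p\<close> is at least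
  1/10^6.\<close>

definition seed_pmf :: "real pmf" where
  "seed_pmf = map_pmf of_bool (bernoulli_pmf (5 / 10 ^ 6))"

definition mixed_algorithm :: algorithm where
  "mixed_algorithm = \<lparr>seed_law = (\<lambda>F. measure_pmf seed_pmf),
     accept = (\<lambda>F u vs ids. threshold F u ids < last vs)\<rparr>"

text \<open>Seed \<open>0\<close> selects the single threshold, seed \<open>1\<close> the switching rule.\<close>

lemma integral_seed:
  "(\<integral>u. (if u = 0 then x else y) \<partial>measure_pmf seed_pmf) = (1 - 5 / 10 ^ 6) * x + 5 / 10 ^ 6 * (y :: real)"
  unfolding seed_pmf_def integral_map_pmf
  by (subst integral_measure_pmf[of UNIV]) (auto simp: UNIV_bool)

lemma identity_truthful_mixed_algorithm: "identity_truthful mixed_algorithm"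
proof -
  have "(\<lambda>(u, v). threshold F u ids < last (map v [0..<Suc (length ids)]))
      \<in> measure_pmf seed_pmf \<Otimes>\<^sub>M PiM {..length ids} (\<lambda>_. borel) \<rightarrow>\<^sub>M count_space UNIV" for F ids
  proof -
    \<comment> \<open>Every function on the discrete seed space is measurable.\<close>
    have [measurable]: "(\<lambda>u. threshold F u ids) \<in> borel_measurable (measure_pmf seed_pmf)" by simp
    have [measurable]: "(\<lambda>v. v (length ids)) \<in> borel_measurable (PiM {..length ids} (\<lambda>_. borel :: real measure))"
      by (rule measurable_component_singleton) simp
    have "(\<lambda>x. threshold F (fst x) ids < snd x (length ids))
      \<in> measure_pmf seed_pmf \<Otimes>\<^sub>M PiM {..length ids} (\<lambda>_. borel) \<rightarrow>\<^sub>M count_space UNIV"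
      by measurable
    then show ?thesis by (simp add: case_prod_beta')
  qed
  then show ?thesis
    by (auto simp: identity_truthful_def mixed_algorithm_def intro: measure_pmf.prob_space_axioms)
qed

lemma accepted_reward_cong:
  assumes "\<And>i. i < n \<Longrightarrow> a i = b i"
  shows "accepted_reward n a v = accepted_reward n b v"
  unfolding accepted_reward_eq_sum using assms by (intro sum.cong) auto

section \<open>Arrival orders of an instance\<close>

text \<open>Steps beyond the last box get a dummy law, since \<open>F ! k\<close> is unspecified there.\<close>

definition step_law :: "real measure list \<Rightarrow> (nat \<Rightarrow> nat) \<Rightarrow> nat \<Rightarrow> real measure" where
  "step_law F \<pi> i = (if i < length F then F ! inv \<pi> i else return borel 0)"

locale arrival =
  fixes F :: "real measure list" and \<pi> :: "nat \<Rightarrow> nat"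
  assumes valid: "valid_instance F" and order: "\<pi> \<in> arrival_orders F"
begin

lemma inv_permutes: "inv \<pi> permutes {..<length F}"
  using order by (auto simp: arrival_orders_def intro: permutes_inv)

lemma inv_less: "i < length F \<Longrightarrow> inv \<pi> i < length F"
  using permutes_in_image[OF inv_permutes, of i] by simp

sublocale reward_sequence "length F" "step_law F \<pi>"
proof (rule reward_sequence.intro)
  have ret: "prob_space (return borel (0::real))" by (rule prob_space_return) simp
  show "prob_space (step_law F \<pi> i)" for i
    using valid_instance_nth(1)[OF valid] inv_less ret by (simp add: step_law_def)
  show "sets (step_law F \<pi> i) = sets borel" for i
    using valid_instance_nth(2)[OF valid] inv_less by (simp add: step_law_def)
  show "integrable (step_law F \<pi> i) (\<lambda>x. x)" for i
  proof -
    have "integrable (return borel 0) (\<lambda>x::real. x)"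
      by (rule integrableI_bounded) (simp_all add: nn_integral_return)
    then show ?thesis
      using valid_instance_integrable[OF valid] inv_less by (simp add: step_law_def)
  qed
qed

lemma reward_law_eq: "reward_law F \<pi> = P"
  unfolding reward_law_def by (intro PiM_cong) (auto simp: step_law_def)

abbreviation "\<tau> \<equiv> balance_level F"

text \<open>A permutation only rearranges the summands, so the balance level of the instance serves
  for every arrival order.\<close>

lemma sum_steps: "(\<Sum>i<length F. g (step_law F \<pi> i)) = (\<Sum>k<length F. g (F ! k) :: real)"
proof -
  have "(\<Sum>k<length F. g (F ! k)) = (\<Sum>i<length F. g (F ! inv \<pi> i))"
    using sum.permute[OF inv_permutes, of "\<lambda>k. g (F ! k)"] by simp
  then show ?thesis by (simp add: step_law_def)
qed

lemma level: "0 < \<tau>" "(\<Sum>i<length F. excess (step_law F \<pi> i) \<tau>) = \<tau>"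
  using balance_level[OF valid] sum_steps[of "\<lambda>D. excess D \<tau>"] by auto

text \<open>The identities seen before step \<open>i\<close> are the image of \<open>{..<i}\<close>
  under \<open>inv \<pi>\<close>, the remaining ones that of \<open>{i..<length F}\<close>;
  injectivity allows reindexing the sums and products.\<close>

lemma switch_after_eq:
  assumes i: "i \<le> length F"
  shows "switch_after F (map (inv \<pi>) [0..<i]) = switch \<tau> i"
proof -
  have inj: "inj_on (inv \<pi>) A" for A
    using permutes_inj[OF inv_permutes] by (auto intro: inj_on_subset)
  have gone: "set (map (inv \<pi>) [0..<i]) = inv \<pi> ` {..<i}"
    by (simp add: atLeast0LessThan)
  have "inv \<pi> ` {i..<length F} = inv \<pi> ` ({..<length F} - {..<i})"
    by (rule arg_cong[where f = "image (inv \<pi>)"]) auto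
  also have "\<dots> = {..<length F} - inv \<pi> ` {..<i}"
    by (subst inj_on_image_set_diff[OF inj[of UNIV]]) (auto simp: permutes_image[OF inv_permutes])
  finally have left: "{..<length F} - set (map (inv \<pi>) [0..<i]) = inv \<pi> ` {i..<length F}"
    by (simp only: gone)
  have minus: "inv \<pi> ` {i..<length F} - {inv \<pi> j} = inv \<pi> ` ({i..<length F} - {j})" for j
    using inj_on_image_set_diff[OF inj[of UNIV], of "{i..<length F}" "{j}"] by simp
  have s: "(\<Sum>k\<in>inv \<pi> ` {..<i}. excess (F ! k) t) = (\<Sum>k<i. excess (step_law F \<pi> k) t)" for t
    unfolding sum.reindex[OF inj] by (intro sum.cong) (use i in \<open>auto simp: step_law_def\<close>)
  have p: "(\<Prod>k\<in>inv \<pi> ` ({i..<length F} - {j}). measure (F ! k) {..t})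
      = (\<Prod>k\<in>{i..<length F} - {j}. measure (step_law F \<pi> k) {..t})" for j t
    unfolding prod.reindex[OF inj] by (intro prod.cong) (auto simp: step_law_def)
  have e: "excess (F ! inv \<pi> j) t = excess (step_law F \<pi> j) t" if "j \<in> {i..<length F}" for j t
    using that by (simp add: step_law_def)
  show ?thesis
    unfolding switch_after_def switch_def Let_def left unfolding gone s Set.bex_simps(7) minus p
    by (simp add: e cong: conj_cong)
qed

lemma alg_reward_mixed:
  "alg_reward mixed_algorithm F \<pi> u v =
     (if u = 0 then reward (\<lambda>i v. \<tau> < v i) v else reward (switching_rule \<tau>) v)"
proof -
  have thr: "threshold F u (map (inv \<pi>) [0..<i]) = (if u = 0 then \<tau> else
      if \<exists>s\<le>i. switch \<tau> s then 99 / 100 * \<tau> else 11 / 10 * \<tau>)" if i: "i < length F" for i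
  proof -
    \<comment> \<open>A prefix of length \<open>s\<close> is the list of identities that was known
      at step \<open>s\<close>.\<close>
    have "switch_after F (take s (map (inv \<pi>) [0..<i])) = switch \<tau> s" if "s \<le> i" for s
      using switch_after_eq[of s] that i by (simp add: take_map)
    then have "(\<exists>s\<le>i. switch_after F (take s (map (inv \<pi>) [0..<i]))) = (\<exists>s\<le>i. switch \<tau> s)"
      by blast
    then show ?thesis by (simp add: threshold_def Let_def)
  qed
  show ?thesis
  proof (cases "u = 0")
    case True
    have "alg_reward mixed_algorithm F \<pi> u v = reward (\<lambda>i v. \<tau> < v i) v"
      unfolding alg_reward_def reward_def
      by (rule accepted_reward_cong) (simp add: mixed_algorithm_def thr[unfolded True] True)
    with True show ?thesis by simp
  next
    case False
    then have "alg_reward mixed_algorithm F \<pi> u v = reward (switching_rule \<tau>) v"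
      unfolding alg_reward_def reward_def
      by (intro accepted_reward_cong) (simp add: mixed_algorithm_def thr switching_rule_def)
    with False show ?thesis by simp
  qed
qed

lemma online_switching_rule: "online (switching_rule \<tau>)"
  unfolding switching_rule_def[abs_def] by (rule online_threshold)

text \<open>Seed and rewards are independent, so integrating over the rewards first leaves a
  two-point mixture.\<close>

lemma expected_alg_mixed:
  "expected_alg mixed_algorithm F \<pi> = (1 - 5 / 10 ^ 6) * integral\<^sup>L P (reward (\<lambda>i v. \<tau> < v i))
     + 5 / 10 ^ 6 * integral\<^sup>L P (reward (switching_rule \<tau>))"
proof -
  define f0 where "f0 = reward (\<lambda>i v. \<tau> < v i)"
  define f1 where "f1 = reward (switching_rule \<tau>)"
  have int: "integrable P f0" "integrable P f1"
    unfolding f0_def f1_def by (intro integrable_reward online_threshold online_switching_rule)+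
  note [measurable] = int[THEN borel_measurable_integrable]
  let ?S = "measure_pmf seed_pmf"
  interpret S: pair_sigma_finite ?S P
    by (intro pair_sigma_finite.intro measure_pmf.sigma_finite_measure_axioms P.sigma_finite_measure_axioms)
  have int_mix: "integrable (?S \<Otimes>\<^sub>M P) (\<lambda>x. if fst x = 0 then f0 (snd x) else f1 (snd x))"
  proof (rule S.Fubini_integrable)
    have [measurable]: "Measurable.pred ?S (\<lambda>u. u = 0)" by simp
    show "(\<lambda>x. if fst x = 0 then f0 (snd x) else f1 (snd x)) \<in> borel_measurable (?S \<Otimes>\<^sub>M P)"
      by measurable
    have "finite (set_pmf seed_pmf)" unfolding seed_pmf_def by simp
    then show "integrable ?S (\<lambda>u. \<integral>v. norm (if fst (u, v) = 0 then f0 (snd (u, v)) else f1 (snd (u, v))) \<partial>P)"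
      by (rule integrable_measure_pmf_finite)
    show "AE u in ?S. integrable P (\<lambda>v. if fst (u, v) = 0 then f0 (snd (u, v)) else f1 (snd (u, v)))"
    proof (rule AE_I2)
      show "integrable P (\<lambda>v. if fst (u, v) = 0 then f0 (snd (u, v)) else f1 (snd (u, v)))" for u
        using int by (cases "u = 0") simp_all
    qed
  qed
  have "integral\<^sup>L (?S \<Otimes>\<^sub>M P) (\<lambda>x. if fst x = 0 then f0 (snd x) else f1 (snd x))
      = (\<integral>u. (if u = 0 then integral\<^sup>L P f0 else integral\<^sup>L P f1) \<partial>?S)"
    by (subst S.integral_fst'[OF int_mix, symmetric])
      (rule Bochner_Integration.integral_cong, auto)
  then show ?thesis
    unfolding expected_alg_def reward_law_eq alg_reward_mixed f0_def[symmetric] f1_def[symmetric]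
    by (simp add: mixed_algorithm_def case_prod_beta' integral_seed)
qed

text \<open>Such a rule reads only the rewards up to step \<open>i\<close>; its measurability is
  pulled back to the full product along the restriction to \<open>{..i}\<close>.\<close>

lemma online_order_aware_rule:
  assumes d: "d \<in> order_aware_rules"
  shows "online (\<lambda>i v. d (map v [0..<Suc i]))"
  unfolding online_def
proof (intro conjI allI impI)
  fix i assume i: "i < length F"
  have [measurable]: "(\<lambda>v. d (map v [0..<Suc i])) \<in> PiM {..i} (\<lambda>_. borel) \<rightarrow>\<^sub>M count_space UNIV"
    using d by (simp add: order_aware_rules_def)
  have r: "(\<lambda>v. restrict v {..i}) \<in> P \<rightarrow>\<^sub>M PiM {..i} (\<lambda>_. borel)"
  proof (rule measurable_restrict)
    fix j assume "j \<in> {..i}"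
    then have "(\<lambda>v. v j) \<in> P \<rightarrow>\<^sub>M step_law F \<pi> j"
      using i by (intro measurable_component_singleton) simp
    then show "(\<lambda>v. v j) \<in> borel_measurable P"
      using measurable_cong_sets[OF refl sets_M] by blast
  qed
  have "(\<lambda>v. d (map (restrict v {..i}) [0..<Suc i])) \<in> P \<rightarrow>\<^sub>M count_space UNIV"
    by (rule measurable_compose[OF r]) measurable
  moreover have "map (restrict v {..i}) [0..<Suc i] = map v [0..<Suc i]" for v :: "nat \<Rightarrow> real"
    by (rule map_cong) auto
  ultimately show "Measurable.pred P (\<lambda>v. d (map v [0..<Suc i]))" by (simp only:)
next
  fix i k :: nat and v :: "nat \<Rightarrow> real" and y assume "i < k"
  then have "map (v(k := y)) [0..<Suc i] = map v [0..<Suc i]" by (intro map_cong) auto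
  then show "d (map (v(k := y)) [0..<Suc i]) = d (map v [0..<Suc i])" by (simp only:)
qed

lemma expected_opt_eq:
  "expected_opt F \<pi> = (SUP d\<in>order_aware_rules. integral\<^sup>L P (reward (\<lambda>i v. d (map v [0..<Suc i]))))"
  by (simp add: expected_opt_def reward_law_eq reward_def[abs_def])

text \<open>Threshold rules compete for the optimum, so its supremum is over a nonempty set.\<close>

lemma threshold_order_aware: "(\<lambda>vs. t < last vs) \<in> order_aware_rules"
proof -
  have "(\<lambda>v. t < v i) \<in> PiM {..i} (\<lambda>_. borel) \<rightarrow>\<^sub>M count_space UNIV" for i :: nat
  proof -
    have [measurable]: "(\<lambda>v. v i) \<in> borel_measurable (PiM {..i} (\<lambda>_. borel :: real measure))"
      by (rule measurable_component_singleton) simp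
    show ?thesis by measurable
  qed
  then show ?thesis by (simp add: order_aware_rules_def)
qed

text \<open>\<open>reward_upper_bound\<close> with \<open>t = l = \<tau>\<close>, where the total
  excess is again \<open>\<tau>\<close>.\<close>

lemma online_reward_le:
  assumes "online a"
  shows "integral\<^sup>L P (reward a) \<le> 2 * \<tau>"
proof -
  have "(\<Sum>i<length F. reach a i * excess (step_law F \<pi> i) \<tau>)
      \<le> (\<Sum>i<length F. excess (step_law F \<pi> i) \<tau>)"
    by (intro sum_mono mult_left_le_one_le excess_nonneg reach_nonneg reach_le_1[OF assms]) auto
  then show ?thesis using reward_upper_bound[OF assms order.refl, of \<tau>] level by simp
qed

text \<open>The single threshold is among the competing rules; the bound \<open>2 * \<tau>\<close>
  also supplies the boundedness that a real supremum requires.\<close>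

lemma expected_opt_bounds: "\<tau> \<le> expected_opt F \<pi>" "expected_opt F \<pi> \<le> 2 * \<tau>"
proof -
  let ?r = "\<lambda>d. integral\<^sup>L P (reward (\<lambda>i v. d (map v [0..<Suc i])))"
  have le: "?r d \<le> 2 * \<tau>" if "d \<in> order_aware_rules" for d
    by (rule online_reward_le[OF online_order_aware_rule[OF that]])
  have "\<tau> \<le> ?r (\<lambda>vs. \<tau> < last vs)"
    using single_threshold_reward[of \<tau>] level by simp
  also have "\<dots> \<le> expected_opt F \<pi>"
    unfolding expected_opt_eq
    by (rule cSUP_upper[OF threshold_order_aware]) (use le in \<open>auto intro!: bdd_aboveI2\<close>)
  finally show "\<tau> \<le> expected_opt F \<pi>" .
  show "expected_opt F \<pi> \<le> 2 * \<tau>"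
    unfolding expected_opt_eq by (rule cSUP_least) (use threshold_order_aware le in auto)
qed

section \<open>The ratio in a fixed order, and the infimum\<close>

text \<open>Either some rule earns more than \<open>199998/100000 \<tau>\<close> and the switching
  rule gains, or the optimum is at most that and the single threshold alone already earns more than
  half of it.\<close>

lemma mixed_algorithm_ratio:
  "1 / 2 + 1 / 10 ^ 8 \<le> expected_alg mixed_algorithm F \<pi> / expected_opt F \<pi>"
proof -
  have single: "\<tau> \<le> integral\<^sup>L P (reward (\<lambda>i v. \<tau> < v i))"
    using single_threshold_reward[of \<tau>] level by simp
  have "(1 / 2 + 1 / 10 ^ 8) * expected_opt F \<pi> \<le> expected_alg mixed_algorithm F \<pi>"
  proof (cases "\<exists>d\<in>order_aware_rules.
      199998 / 100000 * \<tau> < integral\<^sup>L P (reward (\<lambda>i v. d (map v [0..<Suc i])))")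
    case True
    then have "102 / 100 * \<tau> \<le> integral\<^sup>L P (reward (switching_rule \<tau>))"
      using switching_rule_reward[OF level] online_order_aware_rule by blast
    \<comment> \<open>With \<open>p = 5/10^6\<close> the algorithm earns at least
      \<open>(1 + p * 2/100) * \<tau>\<close>, that is \<open>(1 + 1/10^7) * \<tau>\<close>, against
      \<open>(1 + 2/10^8) * \<tau>\<close> needed.\<close>
    then show ?thesis
      using single expected_opt_bounds level(1) unfolding expected_alg_mixed by simp
  next
    case False
    then have "expected_opt F \<pi> \<le> 199998 / 100000 * \<tau>"
      unfolding expected_opt_eq
      by (intro cSUP_least) (use threshold_order_aware in \<open>auto simp: not_less\<close>)
    \<comment> \<open>Nonnegativity of the switching rule suffices here: 1 - 5/10^6 exceeds (1/2 +
      1/10^8) * 1.99998.\<close>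
    moreover have "0 \<le> integral\<^sup>L P (reward (switching_rule \<tau>))"
      unfolding switching_rule_def[abs_def] threshold_reward
      using level(1)
      by (intro sum_nonneg mult_nonneg_nonneg add_nonneg_nonneg excess_nonneg prod_below_bounds) auto
    ultimately show ?thesis
      using single level(1) unfolding expected_alg_mixed by simp
  qed
  moreover have "0 < expected_opt F \<pi>" using expected_opt_bounds(1) level(1) by simp
  ultimately show ?thesis by (simp add: pos_le_divide_eq)
qed

end

text \<open>A bound on a real infimum requires a nonempty index set.\<close>

lemma valid_instance_exists: "valid_instance [return borel 1]"
proof -
  let ?M = "\<lambda>k. [return borel (1::real)] ! k"
  have p: "prob_space (return borel (1::real))" by (rule prob_space_return) simp
  have "(\<integral>\<^sup>+v. ennreal (v 0) \<partial>PiM {..<Suc 0} ?M) = (\<integral>\<^sup>+x. ennreal x \<partial>?M 0)"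
    by (rule nn_integral_PiM_coordinate) (use p in auto)
  then have "(\<integral>\<^sup>+v. ennreal (v 0) \<partial>PiM {0} ?M) = 1"
    by (simp add: nn_integral_return lessThan_Suc)
  moreover have "AE x in M. 0 \<le> x" if M: "M \<in> set [return borel (1::real)]" for M
  proof -
    have "AE x in return borel (1::real). 0 \<le> x" by (subst AE_return) auto
    then show ?thesis using M by (simp only: list.set singleton_iff)
  qed
  ultimately show ?thesis
    using p unfolding valid_instance_def Let_def
    by (intro conjI ballI) (assumption | simp add: lessThan_Suc)+
qed

theorem theorem1:
  "\<exists>ALG. identity_truthful ALG \<and> Gamma_gap ALG > 1/2"
proof -
  \<comment> \<open>The margin is uniform in \<open>F\<close> and \<open>\<pi>\<close>; a merely
    strict bound for each ratio could be lost in the infimum.\<close>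
  have "1 / 2 + 1 / 10 ^ 8 \<le> (MIN \<pi>\<in>arrival_orders F. expected_alg mixed_algorithm F \<pi> / expected_opt F \<pi>)"
    if F: "valid_instance F" for F
  proof (rule Min.boundedI)
    show "finite ((\<lambda>\<pi>. expected_alg mixed_algorithm F \<pi> / expected_opt F \<pi>) ` arrival_orders F)"
      unfolding arrival_orders_def by (intro finite_imageI finite_permutations) simp
    have "id \<in> arrival_orders F" by (simp add: arrival_orders_def permutes_id)
    then show "(\<lambda>\<pi>. expected_alg mixed_algorithm F \<pi> / expected_opt F \<pi>) ` arrival_orders F \<noteq> {}"
      by blast
    show "1 / 2 + 1 / 10 ^ 8 \<le> r"
      if "r \<in> (\<lambda>\<pi>. expected_alg mixed_algorithm F \<pi> / expected_opt F \<pi>) ` arrival_orders F" for r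
      using that arrival.mixed_algorithm_ratio[OF arrival.intro[OF F]] by auto
  qed
  then have "1 / 2 + 1 / 10 ^ 8 \<le> Gamma_gap mixed_algorithm"
    unfolding Gamma_gap_def by (intro cINF_greatest) (use valid_instance_exists in auto)
  then have "Gamma_gap mixed_algorithm > 1 / 2" by simp
  then show ?thesis using identity_truthful_mixed_algorithm by blast
qed

end
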